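(* Let $n,d\ge 1$ be integers, let $f_1,\dots,f_n,h:\mathbb{R}^d\to\mathbb{R}$ be continuously differentiable, and put $\psi:=\frac1n\sum_{i=1}^n f_i+h$. Assume that $f_i$ is $L_i$-smooth for each $i=1,\dots,n$, that $h$ is $L_h$-smooth, and that $\psi$ is $\lambda$-strongly convex, where $L_1,\dots,L_n,L_h,\lambda>0$. Define (batch size $B=1$ and uniform sampling $p_j=1/n$, $j=1,\dots,n$) $s_F:=\frac{2}{\lambda^2n}\sum_{i=1}^nL_i^2$ and $$\bar\eta:=\frac{2}{(s_F+1)\left(\frac1n\sum_{i=1}^n L_i+L_h+\lambda\right)},\qquad \bar q:=\frac{4\lambda\left(\frac1n\sum_{i=1}^n L_i+L_h\right)}{(s_F+1)\left(\frac1n\sum_{i=1}^n L_i+L_h+\lambda\right)^2},$$ $$\tilde\eta:=\frac{1}{2\left(\max_{1\le i\le n}L_i+L_h\right)},\qquad \tilde q:=\frac{\lambda}{2\left(\max_{1\le i\le n}L_i+L_h\right)}.$$ If $\frac2n\sum_{i=1}^nL_i^2\le\lambda^2$, then $\tilde\eta\le\bar\eta$ and $\tilde q\le\bar q$.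
   Context: A continuously differentiable function $g:\mathbb{R}^d\to\mathbb{R}$ is called $L$-smooth ($L>0$) if $\|\nabla g(\boldsymbol{x})-\nabla g(\boldsymbol{y})\|_2\le L\|\boldsymbol{x}-\boldsymbol{y}\|_2$ for all $\boldsymbol{x},\boldsymbol{y}\in\mathbb{R}^d$, and $\lambda$-strongly convex ($\lambda>0$) if $\boldsymbol{x}\mapsto g(\boldsymbol{x})-\frac{\lambda}{2}\|\boldsymbol{x}\|_2^2$ is convex. *)

theory Defs
  imports "HOL-Analysis.Analysis"
begin

text \<open>\<open>grad g x\<close> is meaningful only where \<open>g\<close> has a gradient, which is then unique.\<close>

definition grad :: "('a::real_inner \<Rightarrow> real) \<Rightarrow> 'a \<Rightarrow> 'a" where
  "grad g x = (THE D. GDERIV g x :> D)"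

definition continuously_differentiable :: "('a::real_inner \<Rightarrow> real) \<Rightarrow> bool" where
  "continuously_differentiable g \<longleftrightarrow>
     (\<forall>x. GDERIV g x :> grad g x) \<and> continuous_on UNIV (grad g)"

definition L_smooth :: "real \<Rightarrow> ('a::real_inner \<Rightarrow> real) \<Rightarrow> bool" where
  "L_smooth L g \<longleftrightarrow> 0 < L \<and> continuously_differentiable g \<and>
     (\<forall>x y. norm (grad g x - grad g y) \<le> L * norm (x - y))"

definition strongly_convex :: "real \<Rightarrow> ('a::real_inner \<Rightarrow> real) \<Rightarrow> bool" where
  "strongly_convex lam g \<longleftrightarrow> 0 < lam \<and> continuously_differentiable g \<and>
     convex_on UNIV (\<lambda>x. g x - lam / 2 * (norm x)\<^sup>2)"

definition psi :: "nat \<Rightarrow> (nat \<Rightarrow> 'a::real_inner \<Rightarrow> real) \<Rightarrow> ('a \<Rightarrow> real) \<Rightarrow> 'a \<Rightarrow> real" where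
  "psi n f h x = 1 / real n * (\<Sum>i=1..n. f i x) + h x"

text \<open>In the constants below, \<open>L\<close> is the family of smoothness constants of the \<open>f i\<close> and \<open>Lh\<close> that
  of \<open>h\<close>. The batch size is 1 and the sampling is uniform.\<close>

definition s_F :: "nat \<Rightarrow> (nat \<Rightarrow> real) \<Rightarrow> real \<Rightarrow> real" where
  "s_F n L lam = 2 / (lam\<^sup>2 * real n) * (\<Sum>i=1..n. (L i)\<^sup>2)"

definition eta_bar :: "nat \<Rightarrow> (nat \<Rightarrow> real) \<Rightarrow> real \<Rightarrow> real \<Rightarrow> real" where
  "eta_bar n L Lh lam =
     2 / ((s_F n L lam + 1) * (1 / real n * (\<Sum>i=1..n. L i) + Lh + lam))"

definition q_bar :: "nat \<Rightarrow> (nat \<Rightarrow> real) \<Rightarrow> real \<Rightarrow> real \<Rightarrow> real" where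
  "q_bar n L Lh lam =
     4 * lam * (1 / real n * (\<Sum>i=1..n. L i) + Lh) /
       ((s_F n L lam + 1) * (1 / real n * (\<Sum>i=1..n. L i) + Lh + lam)\<^sup>2)"

definition eta_tilde :: "nat \<Rightarrow> (nat \<Rightarrow> real) \<Rightarrow> real \<Rightarrow> real" where
  "eta_tilde n L Lh = 1 / (2 * (Max (L ` {1..n}) + Lh))"

definition q_tilde :: "nat \<Rightarrow> (nat \<Rightarrow> real) \<Rightarrow> real \<Rightarrow> real \<Rightarrow> real" where
  "q_tilde n L Lh lam = lam / (2 * (Max (L ` {1..n}) + Lh))"

end

theory Submission
  imports Defs
begin

text \<open>A \<open>\<lambda>\<close>-strongly convex function with \<open>A\<close>-Lipschitz gradient on a nonzero space satisfies
  \<open>\<lambda> \<le> A\<close>: strong convexity bounds \<open>\<langle>\<nabla>g(x) - \<nabla>g(y), x - y\<rangle>\<close> from below by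
  \<open>\<lambda>\<parallel>x - y\<parallel>\<^sup>2\<close>, smoothness bounds it from above by \<open>A\<parallel>x - y\<parallel>\<^sup>2\<close>.
  Applied to \<open>\<psi>\<close> with \<open>A\<close> the mean of the \<open>L\<^sub>i\<close> plus \<open>L\<^sub>h\<close>, this yields
  \<open>A + \<lambda> \<le> 2A\<close>; together with \<open>s\<^sub>F + 1 \<le> 2\<close> and \<open>A \<le> max L\<^sub>i + L\<^sub>h\<close>
  it gives both comparisons.\<close>

text \<open>Frechet derivatives are unique and inner products separate vectors, so the definite
  description in \<open>grad\<close> has only one candidate.\<close>

lemma grad_eqI:
  assumes "GDERIV g x :> D"
  shows "grad g x = D"
  unfolding grad_def
proof (rule the_equality)
  fix E assume "GDERIV g x :> E"
  with assms have "(\<lambda>v. v \<bullet> E) = (\<lambda>v. v \<bullet> D)"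
    unfolding gderiv_def by (rule has_derivative_unique[rotated])
  then show "E = D"
    by (metis vector_eq_ldot)
qed (fact assms)

text \<open>Restricting \<open>g\<close> to the line through \<open>x\<close> and \<open>y\<close>
  reduces this to one real variable: an affine path preserves convexity, and the chain rule gives
  its slope at 0. The tangent at 0 is then compared with the value at 1.\<close>

lemma convex_on_above_tangent_GDERIV:
  fixes g :: "'a::real_inner \<Rightarrow> real"
  assumes "convex_on UNIV g" and "GDERIV g x :> D"
  shows "g y - g x \<ge> D \<bullet> (y - x)"
proof -
  define \<phi> where "\<phi> t = g (x + t *\<^sub>R (y - x))" for t :: real
  have "convex_on UNIV \<phi>"
  proof (intro convex_onI convex_UNIV)
    fix t a b :: real assume "0 < t" "t < 1"
    have "x + ((1 - t) *\<^sub>R a + t *\<^sub>R b) *\<^sub>R (y - x)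
        = (1 - t) *\<^sub>R (x + a *\<^sub>R (y - x)) + t *\<^sub>R (x + b *\<^sub>R (y - x))"
      by (simp add: algebra_simps)
    then show "\<phi> ((1 - t) *\<^sub>R a + t *\<^sub>R b) \<le> (1 - t) * \<phi> a + t * \<phi> b"
      using convex_onD[OF assms(1), of t] \<open>0 < t\<close> \<open>t < 1\<close> unfolding \<phi>_def by simp
  qed
  moreover have "(\<phi> has_real_derivative D \<bullet> (y - x)) (at 0)"
  proof -
    have "((\<lambda>t. x + t *\<^sub>R (y - x)) has_derivative (\<lambda>t. t *\<^sub>R (y - x))) (at (0::real))"
      by (auto intro!: derivative_eq_intros)
    moreover have "(g has_derivative (\<lambda>v. v \<bullet> D)) (at (x + 0 *\<^sub>R (y - x)))"
      using assms(2) by (simp add: gderiv_def)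
    ultimately have "(\<phi> has_derivative (\<lambda>t. (t *\<^sub>R (y - x)) \<bullet> D)) (at 0)"
      unfolding \<phi>_def by (rule has_derivative_compose)
    then show ?thesis
      by (simp add: has_field_derivative_def inner_commute mult.commute[of _ "D \<bullet> (y - x)"])
  qed
  ultimately have "\<phi> 1 - \<phi> 0 \<ge> D \<bullet> (y - x) * (1 - 0)"
    by (intro convex_on_imp_above_tangent[where A = UNIV]) auto
  then show ?thesis
    by (simp add: \<phi>_def)
qed

text \<open>Adding the tangent inequalities of the convex function \<open>?u\<close> at
  \<open>x\<close> and at \<open>y\<close> cancels all function values; only the gradients
  remain.\<close>

lemma strongly_convex_grad_monotone:
  assumes "strongly_convex lam g"
  shows "(grad g x - grad g y) \<bullet> (x - y) \<ge> lam * (norm (x - y))\<^sup>2"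
proof -
  let ?u = "\<lambda>x. g x - lam / 2 * (norm x)\<^sup>2"
  have conv: "convex_on UNIV ?u"
    using assms by (simp add: strongly_convex_def)
  have deriv: "GDERIV ?u z :> grad g z - lam *\<^sub>R z" for z
  proof -
    have "(g has_derivative (\<lambda>v. v \<bullet> grad g z)) (at z)"
      using assms by (simp add: strongly_convex_def continuously_differentiable_def gderiv_def)
    then show ?thesis
      unfolding gderiv_def power2_norm_eq_inner
      by (auto intro!: derivative_eq_intros simp: inner_diff_right inner_commute algebra_simps)
  qed
  have "(grad g y - lam *\<^sub>R y) \<bullet> (x - y) + (grad g x - lam *\<^sub>R x) \<bullet> (y - x) \<le> 0"
    using convex_on_above_tangent_GDERIV[OF conv deriv, of x y]
      convex_on_above_tangent_GDERIV[OF conv deriv, of y x] by linarith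
  then show ?thesis
    by (simp add: power2_norm_eq_inner algebra_simps inner_diff_left inner_diff_right inner_commute)
qed

text \<open>A nonzero \<open>e\<close> is compared with 0, with Cauchy-Schwarz linking the two
  bounds. On the zero space both hypotheses about \<open>g\<close> would hold for unrelated
  constants.\<close>

lemma strongly_convex_le_Lipschitz_grad:
  fixes g :: "'a::real_inner \<Rightarrow> real"
  assumes "strongly_convex lam g"
    and "\<And>x y. norm (grad g x - grad g y) \<le> A * norm (x - y)"
    and "\<exists>x :: 'a. x \<noteq> 0"
  shows "lam \<le> A"
proof -
  obtain e :: 'a where "e \<noteq> 0"
    using assms(3) by blast
  have "lam * (norm e)\<^sup>2 \<le> (grad g e - grad g 0) \<bullet> e"
    using strongly_convex_grad_monotone[OF assms(1), of e 0] by simp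
  also have "\<dots> \<le> norm (grad g e - grad g 0) * norm e"
    by (rule norm_cauchy_schwarz)
  also have "\<dots> \<le> A * (norm e)\<^sup>2"
    using mult_right_mono[OF assms(2)[of e 0] norm_ge_zero[of e]]
    by (simp add: power2_eq_square mult.assoc)
  finally show ?thesis
    using \<open>e \<noteq> 0\<close> by simp
qed

lemma grad_psi:
  assumes "\<And>i. i \<in> {1..n} \<Longrightarrow> continuously_differentiable (f i)"
    and "continuously_differentiable h"
  shows "grad (psi n f h) x = (1 / real n) *\<^sub>R (\<Sum>i=1..n. grad (f i) x) + grad h x"
proof (rule grad_eqI)
  have "(f i has_derivative (\<lambda>v. v \<bullet> grad (f i) x)) (at x)" if "i \<in> {1..n}" for i
    using assms(1)[OF that] by (simp add: continuously_differentiable_def gderiv_def)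
  then have "((\<lambda>y. \<Sum>i=1..n. f i y) has_derivative (\<lambda>v. \<Sum>i=1..n. v \<bullet> grad (f i) x)) (at x)"
    by (rule has_derivative_sum)
  moreover have "(h has_derivative (\<lambda>v. v \<bullet> grad h x)) (at x)"
    using assms(2) by (simp add: continuously_differentiable_def gderiv_def)
  ultimately have "(psi n f h has_derivative
      (\<lambda>v. 1 / real n * (\<Sum>i=1..n. v \<bullet> grad (f i) x) + v \<bullet> grad h x)) (at x)"
    unfolding psi_def by (intro has_derivative_add has_derivative_mult_right)
  then show "GDERIV (psi n f h) x :> (1 / real n) *\<^sub>R (\<Sum>i=1..n. grad (f i) x) + grad h x"
    by (simp add: gderiv_def inner_add_right inner_sum_right)
qed

text \<open>By linearity of the gradient and the triangle inequality, Lipschitz constants average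
  and add just as the functions do.\<close>

lemma grad_psi_Lipschitz:
  assumes "\<And>i. i \<in> {1..n} \<Longrightarrow> L_smooth (L i) (f i)" and "L_smooth Lh h"
  shows "norm (grad (psi n f h) x - grad (psi n f h) y)
    \<le> (1 / real n * (\<Sum>i=1..n. L i) + Lh) * norm (x - y)"
proof -
  have "norm ((\<Sum>i=1..n. grad (f i) x) - (\<Sum>i=1..n. grad (f i) y))
      \<le> (\<Sum>i=1..n. L i) * norm (x - y)"
    unfolding sum_subtractf[symmetric] sum_distrib_right
    using assms(1) by (intro sum_norm_le) (simp add: L_smooth_def)
  then have "norm ((1 / real n) *\<^sub>R ((\<Sum>i=1..n. grad (f i) x) - (\<Sum>i=1..n. grad (f i) y)))
      \<le> 1 / real n * ((\<Sum>i=1..n. L i) * norm (x - y))"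
    by (simp add: divide_right_mono)
  moreover have "norm (grad h x - grad h y) \<le> Lh * norm (x - y)"
    using assms(2) by (simp add: L_smooth_def)
  moreover have "grad (psi n f h) z
      = (1 / real n) *\<^sub>R (\<Sum>i=1..n. grad (f i) z) + grad h z" for z
    using assms by (intro grad_psi) (auto simp: L_smooth_def)
  then have "grad (psi n f h) x - grad (psi n f h) y
      = (1 / real n) *\<^sub>R ((\<Sum>i=1..n. grad (f i) x) - (\<Sum>i=1..n. grad (f i) y))
        + (grad h x - grad h y)"
    by (simp add: scaleR_diff_right)
  ultimately show ?thesis
    by (simp only: distrib_right mult.assoc norm_triangle_mono)
qed

lemma mean_le_Max:
  fixes L :: "nat \<Rightarrow> real"
  assumes "n \<ge> 1"
  shows "1 / real n * (\<Sum>i=1..n. L i) \<le> Max (L ` {1..n})"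
proof -
  have "(\<Sum>i=1..n. L i) \<le> (\<Sum>i=1..n. Max (L ` {1..n}))"
    by (intro sum_mono Max_ge) auto
  with assms show ?thesis
    by (simp add: field_simps)
qed

theorem theorem4p3:
  fixes n :: nat
    and f :: "nat \<Rightarrow> real ^ 'd \<Rightarrow> real"
    and h :: "real ^ 'd \<Rightarrow> real"
    and L :: "nat \<Rightarrow> real"
    and Lh lam :: real
  assumes "n \<ge> 1"
    and "\<And>i. i \<in> {1..n} \<Longrightarrow> continuously_differentiable (f i)"
    and "continuously_differentiable h"
    and "\<And>i. i \<in> {1..n} \<Longrightarrow> L i > 0"
    and "Lh > 0"
    and "lam > 0"
    and "\<And>i. i \<in> {1..n} \<Longrightarrow> L_smooth (L i) (f i)"
    and "L_smooth Lh h"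
    and "strongly_convex lam (psi n f h)"
    and "2 / real n * (\<Sum>i=1..n. (L i)\<^sup>2) \<le> lam\<^sup>2"
  shows "eta_tilde n L Lh \<le> eta_bar n L Lh lam \<and> q_tilde n L Lh lam \<le> q_bar n L Lh lam"
proof -
  define A where "A = 1 / real n * (\<Sum>i=1..n. L i) + Lh"
  define M where "M = Max (L ` {1..n}) + Lh"
  define s where "s = s_F n L lam"
  \<comment> \<open>Index types are nonempty, so a unit axis vector exists; this is where d \<ge> 1
    enters.\<close>
  have "\<exists>x :: real ^ 'd. x \<noteq> 0"
    by (metis axis_eq_0_iff zero_neq_one)
  then have "lam \<le> A"
    unfolding A_def
    using strongly_convex_le_Lipschitz_grad[OF assms(9) grad_psi_Lipschitz[OF assms(7,8)]] by blast
  have "A \<le> M"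
    unfolding A_def M_def using mean_le_Max[OF assms(1)] by simp
  \<comment> \<open>Dividing the last hypothesis by \<open>lam\<^sup>2\<close> turns it into
    \<open>s \<le> 1\<close>.\<close>
  have "s = (2 / real n * (\<Sum>i=1..n. (L i)\<^sup>2)) / lam\<^sup>2"
    by (simp add: s_def s_F_def mult.commute)
  also have "\<dots> \<le> 1"
    using assms(6,10) by (subst divide_le_eq_1_pos) auto
  finally have "s \<le> 1" .
  \<comment> \<open>This keeps \<open>s + 1\<close> positive, so the denominators below can be
    compared.\<close>
  have "0 \<le> s"
    unfolding s_def s_F_def by (intro mult_nonneg_nonneg sum_nonneg) auto
  have pos: "0 < lam" "0 < A" "0 < M"
    using assms(6) \<open>lam \<le> A\<close> \<open>A \<le> M\<close> by auto
  have "1 / (2 * M) \<le> 1 / (2 * A)"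
    using pos \<open>A \<le> M\<close> by (simp add: frac_le)
  \<comment> \<open>The bound is chosen so that 2 over it is \<open>1 / (2 * A)\<close>, which is
    \<open>eta_tilde\<close> with \<open>A\<close> in place of \<open>M\<close>.\<close>
  have "(s + 1) * (A + lam) \<le> 2 * (2 * A)"
    using pos \<open>0 \<le> s\<close> \<open>s \<le> 1\<close> \<open>lam \<le> A\<close> by (intro mult_mono) auto
  then have "2 / (2 * (2 * A)) \<le> 2 / ((s + 1) * (A + lam))"
    using pos \<open>0 \<le> s\<close> by (intro divide_left_mono) auto
  with \<open>1 / (2 * M) \<le> 1 / (2 * A)\<close> have eta: "1 / (2 * M) \<le> 2 / ((s + 1) * (A + lam))"
    by simp
  \<comment> \<open>The same two factor bounds, the second one squared, lead to
    \<open>lam / (2 * A)\<close>, the analogue for \<open>q_tilde\<close>.\<close>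
  have "(s + 1) * (A + lam)\<^sup>2 \<le> 2 * (2 * A)\<^sup>2"
    using pos \<open>0 \<le> s\<close> \<open>s \<le> 1\<close> \<open>lam \<le> A\<close> by (intro mult_mono power_mono) auto
  then have "4 * lam * A / (2 * (2 * A)\<^sup>2) \<le> 4 * lam * A / ((s + 1) * (A + lam)\<^sup>2)"
    using pos \<open>0 \<le> s\<close> by (intro divide_left_mono) auto
  moreover have "4 * lam * A / (2 * (2 * A)\<^sup>2) = lam / (2 * A)"
    using pos by (simp add: power2_eq_square)
  moreover have "lam / (2 * M) \<le> lam / (2 * A)"
    using pos \<open>A \<le> M\<close> by (simp add: frac_le)
  ultimately have q: "lam / (2 * M) \<le> 4 * lam * A / ((s + 1) * (A + lam)\<^sup>2)"
    by simp
  show ?thesis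
    using eta q
    unfolding eta_tilde_def eta_bar_def q_tilde_def q_bar_def A_def M_def s_def by blast
qed

end
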